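(* Let $0<\alpha<1$ and $K>0$, and let $a$ be a fixed cut-off function as in the context. Let $\lambda\to\infty$, with $\gamma=\gamma(\lambda)\to\infty$ such that $N=\gamma\lambda$ is an integer, and let $p=p(\lambda)\in[0,1]$ satisfy $$|p-0.5|\le K\lambda^{-\alpha/2}\gamma^{-1/2}.$$ Let $u(x)=\gamma^{-1/2}\lambda^{-1/2}\sum_{j=1}^{N}C_j e^{i\lambda x\cdot\xi_j}$, $x\in\mathbb{R}^2$, be the normalised random wave with directions $\xi_1,\dots,\xi_N$ equally spaced on the unit circle and independent coefficients $C_j$ each equal to $+1$ with probability $p$ and $-1$ with probability $1-p$. Then there are constants $c,C>0$, independent of $\lambda$ and $\gamma$, such that for all sufficiently large $\lambda$ $$c\,\mathrm{Vol}(B_{\lambda^{-\alpha}}(0))\le\mathbb{E}\left[\|a_\lambda u\|_{L^2}^2\right]\le C\,\mathrm{Vol}(B_{\lambda^{-\alpha}}(0)),$$ that is, $u$ satisfies the expectation condition for weak equidistribution on the ball of radius $\lambda^{-\alpha}$.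
   Context: The cut-off $a:\mathbb{R}\to\mathbb{R}$ is a fixed smooth function supported on $[-2,2]$ and equal to $1$ on $[-1,1]$. For $x\in\mathbb{R}^2$ put $a_\lambda(x)=a(\lambda^\alpha|x|)$, so $\|a_\lambda u\|_{L^2}^2=\int_{\mathbb{R}^2}a^2(\lambda^\alpha|x|)\,|u(x)|^2\,dx$; this is the smoothed version of $\int_{B_{\lambda^{-\alpha}}(0)}|u|^2dx$. $B_r(0)\subset\mathbb{R}^2$ is the disc of radius $r$ about $0$ and $\mathrm{Vol}$ is its area. The $N=\gamma\lambda$ directions $\xi_j$ lie on the unit circle $\mathbb{S}\subset\mathbb{R}^2$, with angle $2\pi/(\gamma\lambda)$ between consecutive directions. $\mathbb{E}$ is expectation over the random coefficients. The expectation condition for weak equidistribution on a set $X$ is that $c\,\mathrm{Vol}(X)\le\mathbb{E}[\int_X|u|^2dx]\le C\,\mathrm{Vol}(X)$; here it is understood for $X=B_{\lambda^{-\alpha}}(0)$ with the smoothed integral. *)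

theory Defs
  imports "HOL-Probability.Probability"
begin

definition smooth_cutoff :: "(real \<Rightarrow> real) \<Rightarrow> bool" where
  "smooth_cutoff a \<longleftrightarrow>
     (\<forall>k x. (deriv ^^ k) a differentiable (at x)) \<and>
     closure {t. a t \<noteq> 0} \<subseteq> {-2..2} \<and>
     (\<forall>t\<in>{-1..1}. a t = 1)"

definition scaled_cutoff :: "(real \<Rightarrow> real) \<Rightarrow> real \<Rightarrow> real \<Rightarrow> real^2 \<Rightarrow> real" where
  "scaled_cutoff a \<alpha> lam x = a (lam powr \<alpha> * norm x)"

text \<open>The angle \<open>\<theta>\<close> of the configuration is left free: only the spacing is prescribed.\<close>

definition equally_spaced :: "nat \<Rightarrow> (nat \<Rightarrow> real^2) \<Rightarrow> bool" where
  "equally_spaced N \<xi> \<longleftrightarrow>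
     (\<exists>\<theta>. \<forall>j\<in>{1..N}. \<xi> j = vector [cos (\<theta> + 2 * pi * real j / real N),
                                      sin (\<theta> + 2 * pi * real j / real N)])"

definition sign_coefficients :: "'w measure \<Rightarrow> nat \<Rightarrow> real \<Rightarrow> (nat \<Rightarrow> 'w \<Rightarrow> real) \<Rightarrow> bool" where
  "sign_coefficients M N p X \<longleftrightarrow>
     prob_space M \<and>
     prob_space.indep_vars M (\<lambda>_. borel) X {1..N} \<and>
     (\<forall>j\<in>{1..N}. measure M {\<omega> \<in> space M. X j \<omega> = 1} = p \<and>
                  measure M {\<omega> \<in> space M. X j \<omega> = -1} = 1 - p)"

definition random_wave ::
    "real \<Rightarrow> real \<Rightarrow> nat \<Rightarrow> (nat \<Rightarrow> real^2) \<Rightarrow> (nat \<Rightarrow> 'w \<Rightarrow> real) \<Rightarrow> 'w \<Rightarrow> real^2 \<Rightarrow> complex" where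
  "random_wave \<gamma> lam N \<xi> X \<omega> x =
     of_real (\<gamma> powr (-1/2) * lam powr (-1/2)) *
     (\<Sum>j=1..N. of_real (X j \<omega>) * exp (\<i> * of_real (lam * (x \<bullet> \<xi> j))))"

definition L2_norm :: "(real^2 \<Rightarrow> complex) \<Rightarrow> real" where
  "L2_norm f = sqrt (LINT x|lborel. (cmod (f x))\<^sup>2)"

end

theory Submission
  imports Defs
begin

text \<open>
  With \<open>s = (2p - 1)\<^sup>2\<close> and \<open>G j k\<close> the Fourier integral of \<open>a\<^sub>\<lambda>\<^sup>2\<close> at \<open>\<lambda>(\<xi>\<^sub>j - \<xi>\<^sub>k)\<close>, the expected energy is
  \<open>((1 - s) \<Sum>\<^sub>j G j j + s \<Sum>\<^sub>j\<^sub>k G j k) / N\<close>. The double sum is the energy of the deterministic wave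
  with all coefficients 1, hence nonnegative, so the lower bound only needs \<open>s \<le> 1/2\<close>. By the same
  positivity, \<open>a\<^sub>\<lambda>\<^sup>2\<close> may be replaced in the double sum by a Gaussian majorant of width \<open>\<lambda> powr -\<alpha>\<close>. Its
  Fourier transform is explicit, so no decay estimate for the transform of the cut-off is needed, and
  the equal spacing turns each row into a geometric sum of size \<open>1 + N \<lambda> powr (\<alpha> - 1)\<close>. The
  hypothesis on \<open>p\<close> makes \<open>s\<close> times this quantity bounded.
\<close>

section \<open>Fourier transforms of Gaussians\<close>

text \<open>The integrand is \<open>sqrt (2 * pi)\<close> times the standard normal density at
  \<open>\<mu> * t\<close> times a character of frequency \<open>\<eta> / \<mu>\<close> in that
  variable. A linear substitution therefore reduces the integral to the characteristic function of
  the standard normal distribution.\<close>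

lemma gaussian_fourier_real:
  fixes \<mu> \<eta> :: real
  assumes "0 < \<mu>"
  shows "has_bochner_integral lborel
    (\<lambda>t. complex_of_real (exp (- (\<mu> * t)\<^sup>2 / 2)) * exp (\<i> * complex_of_real (t * \<eta>)))
    (complex_of_real (sqrt (2 * pi) / \<mu> * exp (- \<eta>\<^sup>2 / (2 * \<mu>\<^sup>2))))"
proof -
  let ?g = "\<lambda>t::real. std_normal_density t *\<^sub>R iexp ((\<eta> / \<mu>) * t)"
  let ?f = "\<lambda>t. complex_of_real (exp (- (\<mu> * t)\<^sup>2 / 2)) * exp (\<i> * complex_of_real (t * \<eta>))"
  have int: "integrable lborel ?g"
  proof (rule Bochner_Integration.integrable_bound)
    show "integrable lborel std_normal_density" by simp
  qed (auto simp: norm_exp_i_times)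
  have "char std_normal_distribution (\<eta> / \<mu>) = (LINT t|lborel. ?g t)"
    unfolding char_def by (subst integral_density) (auto simp: normal_density_nonneg)
  hence val: "(LINT t|lborel. ?g t) = complex_of_real (exp (- (\<eta> / \<mu>)\<^sup>2 / 2))"
    by (simp add: char_std_normal_distribution)
  have f: "?f = (\<lambda>t. sqrt (2 * pi) *\<^sub>R ?g (0 + \<mu> * t))"
  proof
    fix t
    have "sqrt (2 * pi) * std_normal_density (\<mu> * t) = exp (- (\<mu> * t)\<^sup>2 / 2)"
      by (simp add: std_normal_density_def)
    moreover have "(\<eta> / \<mu>) * (\<mu> * t) = t * \<eta>" using assms by simp
    ultimately show "?f t = sqrt (2 * pi) *\<^sub>R ?g (0 + \<mu> * t)"
      by (simp only: scaleR_scaleR add_0) (simp add: scaleR_conv_of_real)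
  qed
  have "integrable lborel ?f"
    unfolding f using assms by (intro integrable_scaleR_right lborel_integrable_real_affine int) simp
  moreover have scale: "(LINT t|lborel. ?g t) = \<mu> *\<^sub>R (LINT t|lborel. ?g (0 + \<mu> * t))"
    using lborel_integral_real_affine[of \<mu> ?g 0] assms by simp
  have "(LINT t|lborel. ?g (0 + \<mu> * t)) = (1 / \<mu>) *\<^sub>R (LINT t|lborel. ?g t)"
    unfolding scale using assms by simp
  with val have "(LINT t|lborel. ?f t) = complex_of_real (sqrt (2 * pi) / \<mu> * exp (- \<eta>\<^sup>2 / (2 * \<mu>\<^sup>2)))"
    unfolding f by (simp only: integral_scaleR_right)
      (simp add: scaleR_conv_of_real power_divide mult.commute)
  ultimately show ?thesis by (simp add: has_bochner_integral_iff)
qed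

text \<open>Both the Gaussian and the plane wave factor over the coordinates, so Fubini reduces the
  claim to the one-dimensional transform. Lebesgue measure enters as the image of the product
  measure under the coordinate map \<open>?T\<close>.\<close>

lemma gaussian_fourier_euclidean:
  fixes \<eta> :: "'a::euclidean_space"
  assumes "0 < \<mu>"
  shows "has_bochner_integral lborel
    (\<lambda>x::'a. complex_of_real (exp (- (\<mu> * norm x)\<^sup>2 / 2)) * exp (\<i> * complex_of_real (x \<bullet> \<eta>)))
    (complex_of_real ((sqrt (2 * pi) / \<mu>) ^ DIM('a) * exp (- (norm \<eta>)\<^sup>2 / (2 * \<mu>\<^sup>2))))"
proof -
  let ?h = "\<lambda>b t. complex_of_real (exp (- (\<mu> * t)\<^sup>2 / 2)) * exp (\<i> * complex_of_real (t * (\<eta> \<bullet> b)))"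
  let ?F = "\<lambda>x::'a. complex_of_real (exp (- (\<mu> * norm x)\<^sup>2 / 2)) * exp (\<i> * complex_of_real (x \<bullet> \<eta>))"
  let ?P = "\<Pi>\<^sub>M b\<in>(Basis :: 'a set). (lborel :: real measure)"
  let ?T = "\<lambda>f. \<Sum>b\<in>(Basis :: 'a set). f b *\<^sub>R b"
  interpret product_sigma_finite "\<lambda>_::'a. lborel :: real measure" by standard
  have T [measurable]: "?T \<in> measurable ?P borel" by measurable
  have F [measurable]: "?F \<in> borel_measurable borel"
    by (intro borel_measurable_continuous_onI continuous_intros) simp
  have norm_sum: "(norm (x::'a))\<^sup>2 = (\<Sum>b\<in>Basis. (x \<bullet> b)\<^sup>2)" for x
    by (simp only: power2_norm_eq_inner) (subst euclidean_inner, simp add: power2_eq_square)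
  have prod: "?F (?T f) = (\<Prod>b\<in>Basis. ?h b (f b))" for f
  proof -
    have "(norm (?T f))\<^sup>2 = (\<Sum>b\<in>Basis. (f b)\<^sup>2)" "?T f \<bullet> \<eta> = (\<Sum>b\<in>Basis. f b * (\<eta> \<bullet> b))"
      by (simp_all add: norm_sum inner_sum_left_Basis)
        (simp add: inner_sum_left inner_commute[of \<eta>])
    thus ?thesis
      by (simp add: power_mult_distrib prod.distrib sum_distrib_left sum_divide_distrib sum_negf
          flip: exp_sum of_real_prod)
  qed
  have h: "has_bochner_integral lborel (?h b)
      (complex_of_real (sqrt (2 * pi) / \<mu> * exp (- (\<eta> \<bullet> b)\<^sup>2 / (2 * \<mu>\<^sup>2))))" for b
    by (rule gaussian_fourier_real[OF assms])
  have "integrable ?P (\<lambda>f. ?F (?T f))"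
    unfolding prod using h by (intro product_integrable_prod) (auto simp: has_bochner_integral_iff)
  moreover have "(\<Prod>b\<in>(Basis :: 'a set). sqrt (2 * pi) / \<mu> * exp (- (\<eta> \<bullet> b)\<^sup>2 / (2 * \<mu>\<^sup>2))) =
      (sqrt (2 * pi) / \<mu>) ^ DIM('a) * exp (- (norm \<eta>)\<^sup>2 / (2 * \<mu>\<^sup>2))"
    by (simp only: prod.distrib) (simp add: norm_sum sum_divide_distrib sum_negf flip: exp_sum)
  hence "(LINT f|?P. ?F (?T f)) =
      complex_of_real ((sqrt (2 * pi) / \<mu>) ^ DIM('a) * exp (- (norm \<eta>)\<^sup>2 / (2 * \<mu>\<^sup>2)))"
    unfolding prod using h
    by (subst product_integral_prod)
      (auto simp: has_bochner_integral_iff simp flip: of_real_prod intro!: prod.cong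
        simp del: of_real_mult of_real_divide of_real_power)
  ultimately have "has_bochner_integral ?P (\<lambda>f. ?F (?T f))
      (complex_of_real ((sqrt (2 * pi) / \<mu>) ^ DIM('a) * exp (- (norm \<eta>)\<^sup>2 / (2 * \<mu>\<^sup>2))))"
    by (simp only: has_bochner_integral_iff)
  thus ?thesis
    by (subst lborel_eq) (simp add: has_bochner_integral_iff integrable_distr_eq integral_distr)
qed

text \<open>Real part of the complex transform, in the cosine form in which the energy of a wave
  with real coefficients expands.\<close>

lemma gaussian_cos_integral:
  fixes \<eta> :: "'a::euclidean_space"
  assumes "0 < \<mu>"
  shows "has_bochner_integral lborel
    (\<lambda>x::'a. exp (- (\<mu> * norm x)\<^sup>2 / 2) * cos (x \<bullet> \<eta>))
    ((sqrt (2 * pi) / \<mu>) ^ DIM('a) * exp (- (norm \<eta>)\<^sup>2 / (2 * \<mu>\<^sup>2)))"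
proof -
  have "has_bochner_integral lborel
    (\<lambda>x::'a. Re (complex_of_real (exp (- (\<mu> * norm x)\<^sup>2 / 2)) * exp (\<i> * complex_of_real (x \<bullet> \<eta>))))
    (Re (complex_of_real ((sqrt (2 * pi) / \<mu>) ^ DIM('a) * exp (- (norm \<eta>)\<^sup>2 / (2 * \<mu>\<^sup>2)))))"
    by (rule has_bochner_integral_bounded_linear[OF bounded_linear_Re
        gaussian_fourier_euclidean[OF assms]])
  thus ?thesis by (simp add: Re_exp)
qed

section \<open>The cut-off and its Gaussian majorant\<close>

lemma smooth_cutoff_continuous:
  assumes "smooth_cutoff a"
  shows "continuous_on S a"
proof -
  have "\<forall>x. a differentiable (at x)"
    using assms unfolding smooth_cutoff_def by (metis funpow_0)
  thus ?thesis
    by (intro continuous_at_imp_continuous_on ballI differentiable_imp_continuous_within) simp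
qed

text \<open>By compactness the cut-off is bounded on [-2,2], where the Gaussian stays away from 0;
  elsewhere it vanishes.\<close>

lemma smooth_cutoff_gaussian_bound:
  assumes "smooth_cutoff a"
  obtains D where "0 < D" "\<And>t. (a t)\<^sup>2 \<le> D * exp (- t\<^sup>2 / 2)"
proof -
  have supp: "a t = 0" if "t \<notin> {-2..2}" for t
  proof (rule ccontr)
    assume "a t \<noteq> 0"
    hence "t \<in> closure {t. a t \<noteq> 0}" by (intro subsetD[OF closure_subset]) simp
    thus False using assms that unfolding smooth_cutoff_def by blast
  qed
  have "bounded (a ` {-2..2})"
    by (intro compact_imp_bounded compact_continuous_image smooth_cutoff_continuous assms) simp
  then obtain A where A: "0 < A" "\<And>t. t \<in> {-2..2} \<Longrightarrow> \<bar>a t\<bar> \<le> A"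
    unfolding bounded_pos by auto
  \<comment> \<open>The factor \<open>exp 2\<close> compensates the smallest value exp(-2) of the
    Gaussian on [-2,2].\<close>
  have "(a t)\<^sup>2 \<le> (A\<^sup>2 * exp 2) * exp (- t\<^sup>2 / 2)" for t
  proof (cases "t \<in> {-2..2}")
    case True
    hence "\<bar>t\<bar> \<le> 2" by auto
    hence "t\<^sup>2 \<le> 4" using abs_le_square_iff[of t 2] by simp
    hence "1 \<le> exp 2 * exp (- t\<^sup>2 / 2)" by (simp flip: exp_add)
    moreover have "(a t)\<^sup>2 \<le> A\<^sup>2" using A(2)[OF True] by (rule power2_le_iff_abs_le[THEN iffD2, rotated]) (use A in simp)
    ultimately show ?thesis
      using mult_left_mono[of 1 "exp 2 * exp (- t\<^sup>2 / 2)" "A\<^sup>2"] by (simp add: mult.assoc)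
  qed (use supp[of t] in simp)
  thus ?thesis using A(1) by (intro that[of "A\<^sup>2 * exp 2"]) auto
qed

section \<open>Weighted energies of exponential sums\<close>

lemma cmod_exp_sum_power2:
  "(cmod (\<Sum>j\<in>S. of_real (z j) * exp (\<i> * of_real (\<theta> j))))\<^sup>2 =
    (\<Sum>j\<in>S. \<Sum>k\<in>S. z j * z k * cos (\<theta> j - \<theta> k))"
  by (simp only: cmod_power2) (simp add: Re_exp Im_exp power2_eq_square sum_product cos_diff algebra_simps
      flip: sum.distrib)

text \<open>The squared modulus is a finite combination of cosines, and each cosine times
  \<open>h\<close> is dominated by \<open>h\<close>. The weight stays general so that both the
  squared cut-off and its Gaussian majorant can be inserted.\<close>

lemma integral_cmod_exp_sum:
  fixes h :: "'a::euclidean_space \<Rightarrow> real" and \<eta> :: "'b \<Rightarrow> 'a"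
  assumes h: "integrable lborel h"
  shows integrable_cmod_exp_sum: "integrable lborel
      (\<lambda>x. h x * (cmod (\<Sum>j\<in>S. of_real (z j) * exp (\<i> * of_real (x \<bullet> \<eta> j))))\<^sup>2)" (is ?int)
    and "(LINT x|lborel. h x * (cmod (\<Sum>j\<in>S. of_real (z j) * exp (\<i> * of_real (x \<bullet> \<eta> j))))\<^sup>2) =
      (\<Sum>j\<in>S. \<Sum>k\<in>S. z j * z k * (LINT x|lborel. h x * cos (x \<bullet> (\<eta> j - \<eta> k))))" (is ?eq)
proof -
  have i: "integrable lborel (\<lambda>x. h x * cos (x \<bullet> v))" for v
  proof (rule Bochner_Integration.integrable_bound[OF h])
    have [measurable]: "h \<in> borel_measurable borel" using h by auto
    show "(\<lambda>x. h x * cos (x \<bullet> v)) \<in> borel_measurable lborel" by measurable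
    show "AE x in lborel. norm (h x * cos (x \<bullet> v)) \<le> norm (h x)"
      by (auto simp: abs_mult intro!: mult_left_le)
  qed
  have eq: "h x * (cmod (\<Sum>j\<in>S. of_real (z j) * exp (\<i> * of_real (x \<bullet> \<eta> j))))\<^sup>2 =
      (\<Sum>j\<in>S. \<Sum>k\<in>S. z j * z k * (h x * cos (x \<bullet> (\<eta> j - \<eta> k))))" for x
    by (simp add: cmod_exp_sum_power2 sum_distrib_left inner_diff_right mult_ac)
  show ?int unfolding eq by (intro Bochner_Integration.integrable_sum integrable_mult_right i)
  show ?eq unfolding eq
    by (simp add: Bochner_Integration.integral_sum integrable_mult_right i)
qed

section \<open>Equally spaced directions and row sums\<close>

text \<open>A chord of the unit circle is twice the sine of half the angle it subtends; the free
  rotation \<theta> cancels in the difference of angles.\<close>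

lemma equally_spaced_dist:
  assumes "equally_spaced N \<xi>" "j \<in> {1..N}" "k \<in> {1..N}"
  shows "(norm (\<xi> j - \<xi> k))\<^sup>2 = 4 * (sin (pi * (real j - real k) / real N))\<^sup>2"
proof -
  obtain \<theta> where \<theta>: "\<And>j. j \<in> {1..N} \<Longrightarrow> \<xi> j = vector [cos (\<theta> + 2 * pi * real j / real N),
      sin (\<theta> + 2 * pi * real j / real N)]"
    using assms(1) unfolding equally_spaced_def by blast
  define \<phi> \<psi> where "\<phi> = \<theta> + 2 * pi * real j / real N" and "\<psi> = \<theta> + 2 * pi * real k / real N"
  have "(norm (\<xi> j - \<xi> k))\<^sup>2 = (cos \<phi> - cos \<psi>)\<^sup>2 + (sin \<phi> - sin \<psi>)\<^sup>2"
    using \<theta>[OF assms(2)] \<theta>[OF assms(3)]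
    by (simp only: power2_norm_eq_inner) (simp add: inner_vec_def sum_2 power2_eq_square \<phi>_def \<psi>_def)
  also have "\<dots> = ((sin \<phi>)\<^sup>2 + (cos \<phi>)\<^sup>2) + ((sin \<psi>)\<^sup>2 + (cos \<psi>)\<^sup>2) - 2 * cos (\<phi> - \<psi>)"
    by (simp only: cos_diff) algebra
  also have "\<phi> - \<psi> = 2 * (pi * (real j - real k) / real N)"
    by (simp add: \<phi>_def \<psi>_def field_simps diff_divide_distrib)
  also have "((sin \<phi>)\<^sup>2 + (cos \<phi>)\<^sup>2) + ((sin \<psi>)\<^sup>2 + (cos \<psi>)\<^sup>2) -
      2 * cos (2 * (pi * (real j - real k) / real N)) = 4 * (sin (pi * (real j - real k) / real N))\<^sup>2"
    by (simp only: cos_double_sin sin_cos_squared_add) simp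
  finally show ?thesis .
qed

lemma sin_pi_mult_ge:
  assumes "0 \<le> t" "t \<le> 1/2"
  shows "t \<le> sin (pi * t)"
proof -
  define x where "x = pi * t"
  \<comment> \<open>With x at most 2 the cubic Taylor remainder is at most 2x/3, which leaves sin x
    \<ge> x/3; then pi > 3 gives the claim.\<close>
  have x: "0 \<le> x" "x \<le> 2"
    using assms pi_less_4 mult_mono[of pi 4 t "1/2"] by (auto simp: x_def)
  have "\<bar>sin x - x\<bar> \<le> x ^ 3 / 6"
    using Maclaurin_sin_bound[of x 3] x(1)
    by (simp add: numeral_3_eq_3 sin_coeff_def field_simps)
  also have "x ^ 3 = x * (x * x)" by (simp add: power3_eq_cube)
  also have "x * (x * x) \<le> x * (2 * 2)" using x by (intro mult_left_mono mult_mono) auto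
  finally have "x / 3 \<le> sin x" by linarith
  moreover have "t \<le> x / 3" using assms(1) pi_gt3 mult_right_mono[of 3 pi t] by (simp add: x_def)
  ultimately show ?thesis by (simp add: x_def)
qed

text \<open>For m up to N/2 the sine is at least m/N, and half of the Gaussian decay is traded for
  geometric decay with ratio \<open>q\<close>. The reflection of m to N - m covers the other half of
  the circle. Adding both powers gives one bound valid for all m, ready for summation.\<close>

lemma exp_sin_power2_le:
  fixes R :: real
  assumes "0 \<le> R" "0 < N" "m \<le> N"
  defines "q \<equiv> exp (- (R / real N))"
  shows "exp (- 2 * R\<^sup>2 * (sin (pi * real m / real N))\<^sup>2) \<le> exp 1 * (q ^ m + q ^ (N - m))"
proof -
  have *: "exp (- 2 * R\<^sup>2 * (sin (pi * real d / real N))\<^sup>2) \<le> exp 1 * q ^ d" if "2 * d \<le> N" for d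
  proof -
    define y where "y = real d / real N"
    have y: "0 \<le> y" "y \<le> 1/2" using that assms(2) by (auto simp: y_def field_simps)
    have "y\<^sup>2 \<le> (sin (pi * y))\<^sup>2" by (intro power_mono sin_pi_mult_ge y)
    hence "R\<^sup>2 * y\<^sup>2 \<le> R\<^sup>2 * (sin (pi * y))\<^sup>2" by (intro mult_left_mono) auto
    \<comment> \<open>With z = R y this expression equals 2z^2 - z + 1, so it says -2z^2 \<le> 1 -
      z. The additive 1 is the source of the factor \<open>exp 1\<close>.\<close>
    moreover have "0 \<le> (R * y - 1)\<^sup>2 + (R * y)\<^sup>2 + R * y" using y assms(1) by simp
    ultimately have "- 2 * R\<^sup>2 * (sin (pi * y))\<^sup>2 \<le> 1 - R * y"
      by (simp add: power2_eq_square algebra_simps)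
    hence "exp (- 2 * R\<^sup>2 * (sin (pi * y))\<^sup>2) \<le> exp (1 - R * y)" by simp
    also have "\<dots> = exp 1 * q ^ d"
      by (simp add: q_def y_def exp_diff exp_minus field_simps flip: exp_of_nat_mult)
    finally show ?thesis by (simp add: y_def)
  qed
  have q: "0 \<le> q" by (simp add: q_def)
  show ?thesis
  proof (cases "2 * m \<le> N")
    case True
    from *[OF this] q show ?thesis by (smt (verit) distrib_left exp_gt_zero mult_nonneg_nonneg zero_le_power)
  next
    case False
    hence "2 * (N - m) \<le> N" by simp
    from *[OF this] have "exp (- 2 * R\<^sup>2 * (sin (pi * real (N - m) / real N))\<^sup>2) \<le> exp 1 * q ^ (N - m)" .
    moreover have "pi * real (N - m) / real N = pi - pi * real m / real N"
      using assms by (simp add: of_nat_diff field_simps)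
    hence "sin (pi * real (N - m) / real N) = sin (pi * real m / real N)" by (metis sin_pi_minus)
    ultimately show ?thesis using q by (smt (verit) distrib_left exp_gt_zero mult_nonneg_nonneg zero_le_power)
  qed
qed

text \<open>Each distance m = |j - k| occurs at most once on either side of j, so the row is at most
  twice the sum of \<open>f\<close> over m \<le> N. That sum consists of two equal geometric sums,
  which accounts for the factor 4.\<close>

lemma sum_exp_sin_power2_le:
  fixes R :: real
  assumes "0 < R" "j \<in> {1..N}"
  shows "(\<Sum>k=1..N. exp (- 2 * R\<^sup>2 * (sin (pi * (real j - real k) / real N))\<^sup>2))
    \<le> 4 * exp 1 * (1 + real N / R)"
proof -
  have N: "0 < N" and j: "j \<le> N" using assms(2) by auto
  define q where "q = exp (- (R / real N))"
  define f where "f m = exp 1 * (q ^ m + q ^ (N - m))" for m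
  define b where "b = R / real N"
  have b: "0 < b" using assms N by (simp add: b_def)
  have q: "0 \<le> q" "q < 1" using b by (auto simp: q_def simp flip: b_def)
  have f0: "0 \<le> f m" for m using q by (simp add: f_def)
  let ?e = "\<lambda>k. exp (- 2 * R\<^sup>2 * (sin (pi * (real j - real k) / real N))\<^sup>2)"
  have 1: "?e k \<le> f (j - k)" if "k \<in> {1..j}" for k
    using exp_sin_power2_le[of R N "j - k"] assms that N j by (simp add: f_def q_def of_nat_diff)
  have 2: "?e k \<le> f (k - j)" if "k \<in> {j..N}" for k
  proof -
    have "real j - real k = - real (k - j)" using that by simp
    hence "pi * (real j - real k) / real N = - (pi * real (k - j) / real N)"
      by (simp only: mult_minus_right minus_divide_left)
    hence "(sin (pi * (real j - real k) / real N))\<^sup>2 = (sin (pi * real (k - j) / real N))\<^sup>2"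
      by (simp only: sin_minus power2_minus)
    thus ?thesis using exp_sin_power2_le[of R N "k - j"] assms that N
      by (auto simp: f_def q_def simp del: of_nat_diff)
  qed
  have "(\<Sum>k=1..N. ?e k) \<le> (\<Sum>k\<in>{1..j} \<union> {j..N}. ?e k)" by (intro sum_mono2) auto
  \<comment> \<open>The two ranges share k = j; counting this positive term twice only enlarges the
    bound.\<close>
  also have "\<dots> \<le> (\<Sum>k=1..j. ?e k) + (\<Sum>k=j..N. ?e k)"
    using sum.union_inter[of "{1..j}" "{j..N}" ?e] sum_nonneg[of "{1..j} \<inter> {j..N}" ?e] by simp
  also have "\<dots> \<le> (\<Sum>k=1..j. f (j - k)) + (\<Sum>k=j..N. f (k - j))"
    by (intro add_mono sum_mono 1 2)
  also have "(\<Sum>k=1..j. f (j - k)) = sum f ((\<lambda>k. j - k) ` {1..j})"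
    by (subst sum.reindex) (auto simp: inj_on_def)
  also have "\<dots> \<le> sum f {..N}" using j by (intro sum_mono2 f0) auto
  also have "(\<Sum>k=j..N. f (k - j)) = sum f ((\<lambda>k. k - j) ` {j..N})"
    by (subst sum.reindex) (auto simp: inj_on_def)
  also have "\<dots> \<le> sum f {..N}" by (intro sum_mono2 f0) auto
  also have "sum f {..N} = exp 1 * ((\<Sum>m\<le>N. q ^ m) + (\<Sum>m\<le>N. q ^ (N - m)))"
    by (simp add: f_def sum.distrib flip: sum_distrib_left)
  also have "(\<Sum>m\<le>N. q ^ (N - m)) = (\<Sum>m\<le>N. q ^ m)"
    using sum.nat_diff_reindex[of "\<lambda>m. q ^ m" "Suc N"] by (simp add: lessThan_Suc_atMost)
  also have "(\<Sum>m\<le>N. q ^ m) \<le> 1 / (1 - q)"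
  proof -
    have "(1 - q) * (\<Sum>m\<le>N. q ^ m) \<le> 1" unfolding sum_gp_basic using q by simp
    thus ?thesis using q by (simp add: pos_le_divide_eq mult.commute)
  qed
  \<comment> \<open>Since q = exp(-b), the inequality 1 + b \<le> exp b gives q (1 + b) \<le>
    1.\<close>
  also have "\<dots> \<le> 1 + 1 / b"
  proof -
    have "q * (1 + b) \<le> q * exp b" using q by (intro mult_left_mono) auto
    also have "\<dots> = 1" by (simp add: q_def b_def flip: exp_add)
    finally have "b \<le> (1 - q) * (1 + b)" by (simp add: algebra_simps)
    thus ?thesis using b q by (simp add: field_simps)
  qed
  finally show ?thesis by (simp add: b_def algebra_simps)
qed


section \<open>Second moments of the random signs\<close>

text \<open>On the diagonal the square of a sign is 1 almost surely; off the diagonal independence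
  gives the product of two means, each \<open>2 * p - 1\<close>.\<close>

lemma sign_coefficients_second_moment:
  assumes "sign_coefficients M N p X" "j \<in> {1..N}" "k \<in> {1..N}"
  shows "has_bochner_integral M (\<lambda>\<omega>. X j \<omega> * X k \<omega>) (if j = k then 1 else (2 * p - 1)\<^sup>2)"
proof -
  interpret prob_space M using assms(1) by (simp add: sign_coefficients_def)
  have ind: "indep_vars (\<lambda>_. borel) X {1..N}"
    using assms(1) by (simp add: sign_coefficients_def)
  have rv [measurable]: "random_variable borel (X i)" if "i \<in> {1..N}" for i
    using ind that by (simp add: indep_vars_def)
  let ?A = "\<lambda>i v. {\<omega> \<in> space M. X i \<omega> = v}"
  have ev [measurable]: "?A i v \<in> events" if "i \<in> {1..N}" for i v
    using rv[OF that] by measurable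
  have prob: "prob (?A i 1) = p" "prob (?A i (-1)) = 1 - p" if "i \<in> {1..N}" for i
    using assms(1) that by (auto simp: sign_coefficients_def)
  \<comment> \<open>The values 1 and -1 have probabilities adding up to 1, so any other value is
    taken only on a null set.\<close>
  have sign: "AE \<omega> in M. X i \<omega> = 1 \<or> X i \<omega> = -1" if "i \<in> {1..N}" for i
  proof -
    have "prob (?A i 1 \<union> ?A i (-1)) = 1"
      using prob[OF that] ev[OF that] by (subst finite_measure_Union) auto
    from AE_prob_1[OF this] show ?thesis by eventually_elim auto
  qed
  have int: "integrable M (X i)" if "i \<in> {1..N}" for i
    using sign[OF that] rv[OF that] by (intro integrable_const_bound[where B = 1]) auto
  have mean: "expectation (X i) = 2 * p - 1" if "i \<in> {1..N}" for i
  proof -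
    have "expectation (X i) = expectation (\<lambda>\<omega>. indicator (?A i 1) \<omega> - indicator (?A i (-1)) \<omega>)"
    proof (rule integral_cong_AE)
      show "AE \<omega> in M. X i \<omega> = indicator (?A i 1) \<omega> - indicator (?A i (-1)) \<omega>"
        using sign[OF that] AE_space by eventually_elim auto
    qed (use rv[OF that] ev[OF that] in measurable)
    also have "\<dots> = prob (?A i 1) - prob (?A i (-1))"
      using ev[OF that]
      by (subst Bochner_Integration.integral_diff)
        (auto simp: emeasure_eq_measure intro!: integrable_real_indicator)
    finally show ?thesis using prob[OF that] by simp
  qed
  show ?thesis
  proof (cases "j = k")
    case True
    have "has_bochner_integral M (\<lambda>\<omega>. 1 :: real) 1"
      by (simp add: has_bochner_integral_iff prob_space)
    moreover have "AE \<omega> in M. X j \<omega> * X k \<omega> = 1"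
      using sign[OF assms(2)] by eventually_elim (use True in auto)
    ultimately show ?thesis
      using True rv[OF assms(2)] rv[OF assms(3)]
      by (subst has_bochner_integral_cong_AE[where g = "\<lambda>_. 1"]) auto
  next
    case False
    \<comment> \<open>Pairwise independence is obtained from the family by restricting to the
      disjoint index sets {j} and {k} and evaluating there.\<close>
    have "indep_var borel ((\<lambda>f. f j) \<circ> (\<lambda>\<omega>. restrict (\<lambda>i. X i \<omega>) {j}))
        borel ((\<lambda>f. f k) \<circ> (\<lambda>\<omega>. restrict (\<lambda>i. X i \<omega>) {k}))"
      using False assms by (intro indep_var_compose[OF indep_var_restrict[OF ind]]) auto
    hence "indep_var borel (X j) borel (X k)" by (simp add: comp_def)
    note indep_var_lebesgue_integral[OF this] indep_var_integrable[OF this]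
    thus ?thesis
      using False int assms mean by (simp add: has_bochner_integral_iff power2_eq_square)
  qed
qed

text \<open>The second-moment matrix is (1 - s) times the identity plus s times the all-ones matrix,
  with s the squared mean. Hence only the trace and the full sum of \<open>G\<close> enter.\<close>

lemma sign_coefficients_expected_quadratic_form:
  assumes "sign_coefficients M N p X"
  shows "(LINT \<omega>|M. (\<Sum>j=1..N. \<Sum>k=1..N. X j \<omega> * X k \<omega> * G j k)) =
    (1 - (2 * p - 1)\<^sup>2) * (\<Sum>j=1..N. G j j) + (2 * p - 1)\<^sup>2 * (\<Sum>j=1..N. \<Sum>k=1..N. G j k)"
proof -
  let ?s = "(2 * p - 1)\<^sup>2"
  have "has_bochner_integral M (\<lambda>\<omega>. \<Sum>j=1..N. \<Sum>k=1..N. X j \<omega> * X k \<omega> * G j k)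
      (\<Sum>j=1..N. \<Sum>k=1..N. (if j = k then 1 else ?s) * G j k)"
    by (intro has_bochner_integral_sum has_bochner_integral_mult_left
        sign_coefficients_second_moment[OF assms])
  hence "(LINT \<omega>|M. (\<Sum>j=1..N. \<Sum>k=1..N. X j \<omega> * X k \<omega> * G j k)) =
      (\<Sum>j=1..N. \<Sum>k=1..N. (if j = k then 1 else ?s) * G j k)"
    by (rule has_bochner_integral_integral_eq)
  also have "\<dots> = (\<Sum>j=1..N. \<Sum>k=1..N. (if j = k then (1 - ?s) * G j j else 0) + ?s * G j k)"
    by (intro sum.cong) (auto simp: algebra_simps)
  also have "\<dots> = (1 - ?s) * (\<Sum>j=1..N. G j j) + ?s * (\<Sum>j=1..N. \<Sum>k=1..N. G j k)"
    by (simp add: sum.distrib sum_distrib_left)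
  finally show ?thesis .
qed

section \<open>Energy of the wave as a quadratic form in the coefficients\<close>

lemma powr_neg_half_power2:
  fixes t :: real
  assumes "0 < t"
  shows "(t powr (-1/2))\<^sup>2 = 1 / t"
  using assms by (simp add: powr_minus powr_half_sqrt power_divide inverse_eq_divide
      flip: minus_divide_left)

text \<open>This holds for each outcome \<omega> separately, so that the expectation afterwards acts
  on a finite sum only. The frequency is absorbed into the wave vectors
  \<open>lam *\<^sub>R \<xi> j\<close>.\<close>

lemma random_wave_L2_norm_power2:
  fixes w :: "real^2 \<Rightarrow> real"
  assumes "integrable lborel (\<lambda>x. (w x)\<^sup>2)" "0 < \<gamma>" "0 < lam"
  shows "(L2_norm (\<lambda>x. of_real (w x) * random_wave \<gamma> lam N \<xi> X \<omega> x))\<^sup>2 =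
    (\<Sum>j=1..N. \<Sum>k=1..N. X j \<omega> * X k \<omega> *
      (LINT x|lborel. (w x)\<^sup>2 * cos (x \<bullet> (lam *\<^sub>R \<xi> j - lam *\<^sub>R \<xi> k)))) / (\<gamma> * lam)"
proof -
  have "(cmod (of_real (w x) * random_wave \<gamma> lam N \<xi> X \<omega> x))\<^sup>2 =
      (w x)\<^sup>2 * (cmod (\<Sum>j=1..N. of_real (X j \<omega>) * exp (\<i> * of_real (x \<bullet> (lam *\<^sub>R \<xi> j)))))\<^sup>2 /
        (\<gamma> * lam)" for x
    using powr_neg_half_power2[OF assms(2)] powr_neg_half_power2[OF assms(3)]
    by (simp add: random_wave_def norm_mult power_mult_distrib)
  moreover have norm: "(L2_norm f)\<^sup>2 = (LINT x|lborel. (cmod (f x))\<^sup>2)" for f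
    by (simp add: L2_norm_def integral_nonneg_AE)
  ultimately have "(LINT x|lborel. (cmod (of_real (w x) * random_wave \<gamma> lam N \<xi> X \<omega> x))\<^sup>2) =
      (LINT x|lborel. (w x)\<^sup>2 * (cmod (\<Sum>j=1..N. of_real (X j \<omega>) *
        exp (\<i> * of_real (x \<bullet> (lam *\<^sub>R \<xi> j)))))\<^sup>2) / (\<gamma> * lam)"
    by (simp only: integral_divide_zero)
  also note integral_cmod_exp_sum(2)[OF assms(1), where S = "{1..N}"]
  finally show ?thesis by (simp only: norm)
qed


section \<open>Bounds at a fixed frequency\<close>

lemma measure_ball_real2:
  assumes "0 < r"
  shows "measure lborel (ball (0 :: real^2) r) = pi * r\<^sup>2"
  using assms by (simp add: content_ball unit_ball_vol_2)

text \<open>A version with explicit constants for a single frequency: the limit enters only through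
  the thresholds on \<open>lam\<close> and \<open>\<gamma>\<close>. The condition
  \<open>8 * K\<^sup>2 \<le> \<gamma>\<close> is what makes s at most 1/2.\<close>

lemma expected_energy_bounds:
  fixes a :: "real \<Rightarrow> real"
  assumes a: "smooth_cutoff a" and D: "\<And>t. (a t)\<^sup>2 \<le> D * exp (- t\<^sup>2 / 2)"
    and \<alpha>: "0 < \<alpha>" "\<alpha> < 1" and lam: "1 \<le> lam" and \<gamma>: "1 \<le> \<gamma>" "8 * K\<^sup>2 \<le> \<gamma>"
    and N: "real N = \<gamma> * lam"
    and p: "\<bar>p - 1/2\<bar> \<le> K * lam powr (-\<alpha>/2) * \<gamma> powr (-1/2)"
    and \<xi>: "equally_spaced N \<xi>" and X: "sign_coefficients M N p X"
  defines "vol \<equiv> measure lborel (ball (0 :: real^2) (lam powr (-\<alpha>)))"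
    and "E \<equiv> (LINT \<omega>|M. (L2_norm (\<lambda>x. of_real (scaled_cutoff a \<alpha> lam x) *
          random_wave \<gamma> lam N \<xi> X \<omega> x))\<^sup>2)"
  shows "1/2 * vol \<le> E" "E \<le> 2 * D * (1 + 32 * exp 1 * K\<^sup>2) * vol"
proof -
  \<comment> \<open>Here \<mu> is the reciprocal of the radius of the ball, \<open>R\<close> is
    frequency times radius, and \<open>s\<close> is the squared mean of a coefficient.\<close>
  define \<mu> where "\<mu> = lam powr \<alpha>"
  define R where "R = lam powr (1 - \<alpha>)"
  define s where "s = (2 * p - 1)\<^sup>2"
  define h where "h x = (scaled_cutoff a \<alpha> lam x)\<^sup>2" for x
  define g where "g x = exp (- (\<mu> * norm x)\<^sup>2 / 2)" for x :: "real^2"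
  define \<eta> where "\<eta> j = lam *\<^sub>R \<xi> j" for j
  define G where "G j k = (LINT x|lborel. h x * cos (x \<bullet> (\<eta> j - \<eta> k)))" for j k
  define G0 where "G0 = (LINT x|lborel. h x)"
  have \<mu>: "1 \<le> \<mu>" and R: "0 < R" using lam \<alpha> by (auto simp: \<mu>_def R_def ge_one_powr_ge_zero)
  have \<mu>R: "\<mu> * R = lam" using lam by (simp add: \<mu>_def R_def flip: powr_add)
  have vol: "vol = pi / \<mu>\<^sup>2" using lam
    by (simp add: vol_def measure_ball_real2 \<mu>_def powr_minus power_inverse field_simps)
  have D0: "0 \<le> D" using D[of 0] order_trans[OF zero_le_power2] by fastforce
  have s0: "0 \<le> s" by (simp add: s_def)
  have N0: "0 < real N" using N lam \<gamma> by simp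
  have s_le: "s \<le> 4 * K\<^sup>2 / (\<mu> * \<gamma>)"
  proof -
    have "lam powr (-\<alpha>/2) = \<mu> powr (-1/2)" by (simp add: \<mu>_def powr_powr)
    hence "(p - 1/2)\<^sup>2 \<le> (K * \<mu> powr (-1/2) * \<gamma> powr (-1/2))\<^sup>2"
      using p by (metis power2_abs power_mono abs_ge_zero)
    also have "\<dots> = K\<^sup>2 / (\<mu> * \<gamma>)"
      using powr_neg_half_power2[of \<mu>] powr_neg_half_power2[of \<gamma>] \<mu> \<gamma> by (simp add: power_mult_distrib)
    finally have "4 * (p - 1/2)\<^sup>2 \<le> 4 * K\<^sup>2 / (\<mu> * \<gamma>)" by simp
    thus ?thesis by (simp add: s_def power2_eq_square algebra_simps)
  qed
  have s_half: "s \<le> 1/2"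
  proof -
    have "\<gamma> \<le> \<mu> * \<gamma>" using \<mu> \<gamma> by simp
    hence "8 * K\<^sup>2 \<le> \<mu> * \<gamma>" using \<gamma> by linarith
    hence "4 * K\<^sup>2 / (\<mu> * \<gamma>) \<le> 1/2" using \<mu> \<gamma> by (simp add: field_simps)
    thus ?thesis using s_le by simp
  qed
  have h_le: "h x \<le> D * g x" for x
    using D[of "\<mu> * norm x"] by (simp add: h_def g_def scaled_cutoff_def \<mu>_def)
  have h0: "0 \<le> h x" for x by (simp add: h_def)
  \<comment> \<open>In dimension 2 the total mass of the Gaussian is 2 pi / \<mu>^2, twice the area
    of the ball.\<close>
  have gauss: "has_bochner_integral lborel (\<lambda>x. g x * cos (x \<bullet> v))
      (2 * vol * exp (- (norm v)\<^sup>2 / (2 * \<mu>\<^sup>2)))" for v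
    using gaussian_cos_integral[of \<mu> v] \<mu> by (simp add: g_def vol power_divide)
  from gauss[of 0] have int_g: "integrable lborel g" "(LINT x|lborel. g x) = 2 * vol"
    by (auto simp: has_bochner_integral_iff)
  have int_h: "integrable lborel h"
  proof (rule Bochner_Integration.integrable_bound)
    show "integrable lborel (\<lambda>x. D * g x)" using int_g by simp
    show "h \<in> borel_measurable lborel"
      using borel_measurable_continuous_onI[OF smooth_cutoff_continuous[OF a]]
      unfolding h_def scaled_cutoff_def by measurable
    show "AE x in lborel. norm (h x) \<le> norm (D * g x)"
      using h_le h0 by (intro AE_I2) (metis abs_of_nonneg order_trans real_norm_def)
  qed
  have "E = (LINT \<omega>|M. (\<Sum>j=1..N. \<Sum>k=1..N. X j \<omega> * X k \<omega> * G j k) / real N)"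
    using lam \<gamma>
    by (simp add: E_def N h_def G_def \<eta>_def
        random_wave_L2_norm_power2[OF int_h[unfolded h_def[abs_def]]])
  also have "\<dots> = ((1 - s) * (\<Sum>j=1..N. G j j) + s * (\<Sum>j=1..N. \<Sum>k=1..N. G j k)) / real N"
    by (simp only: integral_divide_zero sign_coefficients_expected_quadratic_form[OF X] s_def)
  also have "(\<Sum>j=1..N. G j j) = real N * G0" by (simp add: G_def G0_def)
  finally have E: "E = (1 - s) * G0 + s * (\<Sum>j=1..N. \<Sum>k=1..N. G j k) / real N"
    using N0 by (simp add: field_simps)
  \<comment> \<open>Setting all coefficients to 1 turns the double sum into the weighted energy of a
    deterministic wave.\<close>
  note G_sum = integral_cmod_exp_sum[where S = "{1..N}" and z = "\<lambda>_. 1" and \<eta> = \<eta>, simplified]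
  have G_eq: "(\<Sum>j=1..N. \<Sum>k=1..N. G j k) =
      (LINT x|lborel. h x * (cmod (\<Sum>j=1..N. exp (\<i> * of_real (x \<bullet> \<eta> j))))\<^sup>2)"
    using G_sum(2)[OF int_h] by (simp add: G_def)
  have G_nonneg: "0 \<le> (\<Sum>j=1..N. \<Sum>k=1..N. G j k)"
    unfolding G_eq using h0 by (intro integral_nonneg_AE) auto
  have vol_le: "vol \<le> G0"
  proof -
    have "vol = (LINT x|lborel. indicator (ball (0 :: real^2) (lam powr (-\<alpha>))) x)"
      by (simp add: vol_def)
    also have "\<dots> \<le> G0"
      unfolding G0_def
    proof (rule integral_mono[OF _ int_h])
      show "integrable lborel (indicator (ball (0 :: real^2) (lam powr (-\<alpha>))) :: _ \<Rightarrow> real)"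
        using emeasure_lborel_ball_finite by (intro integrable_real_indicator) auto
      fix x :: "real^2"
      show "indicator (ball 0 (lam powr (-\<alpha>))) x \<le> h x"
      proof (cases "norm x < lam powr (-\<alpha>)")
        case True
        hence "\<mu> * norm x \<le> 1" using lam by (simp add: \<mu>_def powr_minus field_simps)
        moreover have "0 \<le> \<mu> * norm x" using \<mu> by simp
        ultimately have "a (\<mu> * norm x) = 1" using a by (simp add: smooth_cutoff_def)
        thus ?thesis by (simp add: h_def scaled_cutoff_def \<mu>_def indicator_def)
      qed (simp add: h0)
    qed
    finally show ?thesis .
  qed
  have G0_le: "G0 \<le> 2 * D * vol"
    using integral_mono[OF int_h _ h_le] int_g by (simp add: G0_def)
  \<comment> \<open>The weights are compared under the integral against the nonnegative squared
    modulus. Comparing entry by entry would fail, as the cosines change sign.\<close>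
  have "(\<Sum>j=1..N. \<Sum>k=1..N. G j k) \<le>
      (LINT x|lborel. D * (g x * (cmod (\<Sum>j=1..N. exp (\<i> * of_real (x \<bullet> \<eta> j))))\<^sup>2))"
    unfolding G_eq
  proof (rule integral_mono)
    fix x
    show "h x * (cmod (\<Sum>j=1..N. exp (\<i> * of_real (x \<bullet> \<eta> j))))\<^sup>2 \<le>
        D * (g x * (cmod (\<Sum>j=1..N. exp (\<i> * of_real (x \<bullet> \<eta> j))))\<^sup>2)"
      using mult_right_mono[OF h_le] by (simp add: mult.assoc)
  qed (use G_sum(1)[OF int_h] G_sum(1)[OF int_g(1)] in auto)
  also have "\<dots> = D * (\<Sum>j=1..N. \<Sum>k=1..N. 2 * vol * exp (- (norm (\<eta> j - \<eta> k))\<^sup>2 / (2 * \<mu>\<^sup>2)))"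
    using G_sum(2)[OF int_g(1)] has_bochner_integral_integral_eq[OF gauss] by simp
  also have "\<dots> = 2 * D * vol * (\<Sum>j=1..N. \<Sum>k=1..N. exp (- 2 * R\<^sup>2 * (sin (pi * (real j - real k) / real N))\<^sup>2))"
  proof -
    have "(norm (\<eta> j - \<eta> k))\<^sup>2 / (2 * \<mu>\<^sup>2) = 2 * R\<^sup>2 * (sin (pi * (real j - real k) / real N))\<^sup>2"
      if "j \<in> {1..N}" "k \<in> {1..N}" for j k
    proof -
      have "norm (\<eta> j - \<eta> k) = \<mu> * R * norm (\<xi> j - \<xi> k)"
        using lam by (simp add: \<eta>_def \<mu>R flip: scaleR_diff_right)
      thus ?thesis using equally_spaced_dist[OF \<xi> that] \<mu>
        by (simp add: power_mult_distrib)
    qed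
    thus ?thesis by (simp add: sum_distrib_left mult_ac)
  qed
  also have "\<dots> \<le> 2 * D * vol * (\<Sum>j=1..N. 4 * exp 1 * (1 + real N / R))"
    using R D0 by (intro mult_left_mono sum_mono sum_exp_sin_power2_le) (auto simp: vol)
  finally have G_le: "(\<Sum>j=1..N. \<Sum>k=1..N. G j k) / real N \<le> 2 * D * vol * (4 * exp 1 * (1 + real N / R))"
    using N0 by (simp add: field_simps)
  \<comment> \<open>As N / R = \<mu> \<gamma> \<ge> 1, the row-sum factor is at most 2 \<mu>
    \<gamma>, which cancels the denominator in \<open>s_le\<close>.\<close>
  have sR: "s * (1 + real N / R) \<le> 8 * K\<^sup>2"
  proof -
    have "real N / R = \<mu> * \<gamma>" using R \<mu>R by (simp add: N field_simps)
    moreover have \<mu>\<gamma>: "1 \<le> \<mu> * \<gamma>" using mult_mono[of 1 \<mu> 1 \<gamma>] \<mu> \<gamma> by simp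
    ultimately have "s * (1 + real N / R) \<le> 4 * K\<^sup>2 / (\<mu> * \<gamma>) * (2 * (\<mu> * \<gamma>))"
      using s_le s0 by (intro mult_mono) linarith+
    also have "\<dots> = 8 * K\<^sup>2" using \<mu> \<gamma> by (simp add: field_simps)
    finally show ?thesis .
  qed
  have "s * ((\<Sum>j=1..N. \<Sum>k=1..N. G j k) / real N)
      \<le> s * (2 * D * vol * (4 * exp 1 * (1 + real N / R)))"
    by (rule mult_left_mono[OF G_le s0])
  also have "\<dots> = 2 * D * vol * (4 * exp 1) * (s * (1 + real N / R))"
    by (simp only: mult_ac)
  also have "\<dots> \<le> 2 * D * vol * (4 * exp 1) * (8 * K\<^sup>2)"
    using D0 by (intro mult_left_mono sR) (simp add: vol)
  finally have "s * ((\<Sum>j=1..N. \<Sum>k=1..N. G j k) / real N)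
      \<le> 2 * D * vol * (4 * exp 1) * (8 * K\<^sup>2)" .
  moreover have "(1 - s) * G0 \<le> 2 * D * vol"
  proof -
    have "0 \<le> G0" using h0 unfolding G0_def by (intro integral_nonneg_AE) auto
    hence "0 \<le> s * G0" using s0 by simp
    thus ?thesis using G0_le by (simp add: left_diff_distrib)
  qed
  ultimately show "E \<le> 2 * D * (1 + 32 * exp 1 * K\<^sup>2) * vol"
    unfolding E by (simp add: algebra_simps)
  \<comment> \<open>The diagonal alone gives the lower bound; the remaining term is
    nonnegative.\<close>
  have "1/2 * vol \<le> (1 - s) * G0"
    using vol_le s_half by (intro mult_mono) (auto simp: vol)
  moreover have "0 \<le> s * (\<Sum>j=1..N. \<Sum>k=1..N. G j k) / real N"
    using G_nonneg s0 by simp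
  ultimately show "1/2 * vol \<le> E" unfolding E by linarith
qed

section \<open>Uniform constants and large frequencies\<close>

theorem corollary2p4:
  fixes \<alpha> K :: real and a :: "real \<Rightarrow> real"
  assumes "0 < \<alpha>" and "\<alpha> < 1" and "0 < K" and "smooth_cutoff a"
  shows "\<exists>c>0. \<exists>C>0.
    \<forall>(\<gamma> :: real \<Rightarrow> real) (N :: real \<Rightarrow> nat) (p :: real \<Rightarrow> real) (\<xi> :: real \<Rightarrow> nat \<Rightarrow> real^2)
      (M :: real \<Rightarrow> 'w measure) (X :: real \<Rightarrow> nat \<Rightarrow> 'w \<Rightarrow> real).
      filterlim \<gamma> at_top at_top \<longrightarrow>
      (\<forall>\<^sub>F lam in at_top.
         real (N lam) = \<gamma> lam * lam \<and>
         0 \<le> p lam \<and> p lam \<le> 1 \<and>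
         \<bar>p lam - 1/2\<bar> \<le> K * lam powr (-\<alpha>/2) * \<gamma> lam powr (-1/2) \<and>
         equally_spaced (N lam) (\<xi> lam) \<and>
         sign_coefficients (M lam) (N lam) (p lam) (X lam)) \<longrightarrow>
      (\<forall>\<^sub>F lam in at_top.
         let vol = measure lborel (ball (0 :: real^2) (lam powr (-\<alpha>)));
             E = (LINT \<omega>|M lam.
                    (L2_norm (\<lambda>x. of_real (scaled_cutoff a \<alpha> lam x) *
                                  random_wave (\<gamma> lam) lam (N lam) (\<xi> lam) (X lam) \<omega> x))\<^sup>2)
         in c * vol \<le> E \<and> E \<le> C * vol)"
  proof -
  obtain D where D: "0 < D" "\<And>t. (a t)\<^sup>2 \<le> D * exp (- t\<^sup>2 / 2)"
    using smooth_cutoff_gaussian_bound[OF assms(4)] by blast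
  \<comment> \<open>This constant depends only on \<open>K\<close> and, through \<open>D\<close>, on
    the cut-off, so it may be chosen before \<gamma> and all other data.\<close>
  let ?C = "2 * D * (1 + 32 * exp 1 * K\<^sup>2)"
  have C: "0 < ?C" using D(1) by (intro mult_pos_pos add_pos_nonneg) auto
  show ?thesis
  proof (rule exI[of _ "1/2"], intro conjI exI[of _ ?C] allI impI C)
    fix \<gamma> :: "real \<Rightarrow> real" and N :: "real \<Rightarrow> nat" and p :: "real \<Rightarrow> real"
      and \<xi> :: "real \<Rightarrow> nat \<Rightarrow> real^2" and M :: "real \<Rightarrow> 'w measure"
      and X :: "real \<Rightarrow> nat \<Rightarrow> 'w \<Rightarrow> real"
    assume "filterlim \<gamma> at_top at_top"
    hence "\<forall>\<^sub>F lam in at_top. max 1 (8 * K\<^sup>2) \<le> \<gamma> lam"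
      unfolding filterlim_at_top by blast
    moreover assume "\<forall>\<^sub>F lam in at_top.
         real (N lam) = \<gamma> lam * lam \<and>
         0 \<le> p lam \<and> p lam \<le> 1 \<and>
         \<bar>p lam - 1/2\<bar> \<le> K * lam powr (-\<alpha>/2) * \<gamma> lam powr (-1/2) \<and>
         equally_spaced (N lam) (\<xi> lam) \<and>
         sign_coefficients (M lam) (N lam) (p lam) (X lam)"
    moreover have "\<forall>\<^sub>F lam in at_top. (1::real) \<le> lam" by (rule eventually_ge_at_top)
    ultimately show "\<forall>\<^sub>F lam in at_top.
         let vol = measure lborel (ball (0 :: real^2) (lam powr (-\<alpha>)));
             E = (LINT \<omega>|M lam.
                    (L2_norm (\<lambda>x. of_real (scaled_cutoff a \<alpha> lam x) *
                                  random_wave (\<gamma> lam) lam (N lam) (\<xi> lam) (X lam) \<omega> x))\<^sup>2)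
         in 1/2 * vol \<le> E \<and> E \<le> ?C * vol"
    proof eventually_elim
      case (elim lam)
      thus ?case
        unfolding Let_def
        using expected_energy_bounds[OF assms(4) D(2) assms(1,2), of lam "\<gamma> lam" K "N lam" "p lam"
            "\<xi> lam" "M lam" "X lam"] by simp
    qed
  qed simp
qed

end
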